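(* Let $\mathcal{C}$ be a well-powered finitely well complete category. For every commutator $\mathrm{C}$ on $\mathcal{C}$ and every object $A$ in $\mathcal{C}$, with $\mathrm{ER}(A)$ equipped with the multiplication $\mathrm{C}_A$ (making it a complete multiplicative lattice), the space $\mathrm{Spec}(\mathrm{ER}(A))$ is sober.
   Context: A category $\mathcal{C}$ is called here well-powered finitely well complete if: it has finite limits; for every object $C$, the class $\mathrm{Sub}(C)$ of isomorphism classes of monomorphisms into $C$ is a set; and each $\mathrm{Sub}(C)$, as an ordered set, is a complete lattice with meets being limits of suitable diagrams in $\mathcal{C}$. Then for each object $A$, the set $\mathrm{ER}(A)$ of (isomorphism classes of) internal equivalence relations on $A$ is a complete lattice. For a morphism $\alpha:A\to B$, the map $\mathrm{ER}(\alpha):\mathrm{ER}(B)\to\mathrm{ER}(A)$ is given by pulling back along $\alpha\times\alpha:A\times A\to B\times B$. A commutator $\mathrm{C}$ on $\mathcal{C}$ is a (large) family of binary operations $\mathrm{C}_A:\mathrm{ER}(A)\times\mathrm{ER}(A)\to\mathrm{ER}(A)$, one for each object $A$, written $\mathrm{C}_A(x,y)=xy$, such that (a) $xy\leqslant x\wedge y$ for all $A$ and all $x,y\in\mathrm{ER}(A)$; (b) $(\mathrm{ER}(\alpha)(x))(\mathrm{ER}(\alpha)(y))\leqslant\mathrm{ER}(\alpha)(xy)$ for all $\alpha:A\to B$ and all $x,y\in\mathrm{ER}(B)$. A complete multiplicative lattice is a complete lattice $L$ with a binary multiplication satisfying $xy\leqslant x\wedge y$ for all $x,y\in L$. An element $p\neq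 1$ of $L$ (where $1$ is the largest element) is prime if for all $x,y\in L$, $xy\leqslant p$ implies $x\leqslant p$ or $y\leqslant p$. $\mathrm{Spec}(L)$ is the set of prime elements of $L$ with the Zariski topology, whose closed sets are exactly the sets $\mathrm{V}(x)=\{p\in\mathrm{Spec}(L)\mid x\leqslant p\}$, $x\in L$. A space is sober if it is $\mathrm{T}_0$ and every irreducible closed subset is the closure of a one-element set. *)

theory Defs
  imports
    "HOL-Analysis.Analysis"
    "HOL-Algebra.Complete_Lattice"
begin

section \<open>Categories and limits\<close>

record ('o, 'm) cat =
  Obj :: "'o set"
  Arr :: "'m set"
  Dom :: "'m \<Rightarrow> 'o"
  Cod :: "'m \<Rightarrow> 'o"
  Idn :: "'o \<Rightarrow> 'm"
  Cmp :: "'m \<Rightarrow> 'm \<Rightarrow> 'm"  (infixr \<open>\<cdot>\<index>\<close> 75)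

definition Hom :: "('o, 'm) cat \<Rightarrow> 'o \<Rightarrow> 'o \<Rightarrow> 'm set" where
  "Hom C A B = {f \<in> Arr C. Dom C f = A \<and> Cod C f = B}"

locale category =
  fixes C :: "('o, 'm) cat" (structure)
  assumes dom_in_Obj: "f \<in> Arr C \<Longrightarrow> Dom C f \<in> Obj C"
    and cod_in_Obj: "f \<in> Arr C \<Longrightarrow> Cod C f \<in> Obj C"
    and Idn_in_Hom: "A \<in> Obj C \<Longrightarrow> Idn C A \<in> Hom C A A"
    and Cmp_in_Hom: "f \<in> Hom C X Y \<Longrightarrow> g \<in> Hom C Y Z \<Longrightarrow> g \<cdot> f \<in> Hom C X Z"
    and Cmp_assoc: "f \<in> Hom C W X \<Longrightarrow> g \<in> Hom C X Y \<Longrightarrow> h \<in> Hom C Y Z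
      \<Longrightarrow> (h \<cdot> g) \<cdot> f = h \<cdot> (g \<cdot> f)"
    and Cmp_Idn_right: "f \<in> Hom C X Y \<Longrightarrow> f \<cdot> Idn C X = f"
    and Cmp_Idn_left: "f \<in> Hom C X Y \<Longrightarrow> Idn C Y \<cdot> f = f"

definition is_functor ::
  "('i, 'j) cat \<Rightarrow> ('o, 'm) cat \<Rightarrow> ('i \<Rightarrow> 'o) \<Rightarrow> ('j \<Rightarrow> 'm) \<Rightarrow> bool" where
  "is_functor J C F\<^sub>o F\<^sub>a \<longleftrightarrow>
     category J \<and> category C \<and>
     (\<forall>i\<in>Obj J. F\<^sub>o i \<in> Obj C) \<and>
     (\<forall>i j. \<forall>u\<in>Hom J i j. F\<^sub>a u \<in> Hom C (F\<^sub>o i) (F\<^sub>o j)) \<and>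
     (\<forall>i\<in>Obj J. F\<^sub>a (Idn J i) = Idn C (F\<^sub>o i)) \<and>
     (\<forall>i j k. \<forall>u\<in>Hom J i j. \<forall>v\<in>Hom J j k. F\<^sub>a (v \<cdot>\<^bsub>J\<^esub> u) = F\<^sub>a v \<cdot>\<^bsub>C\<^esub> F\<^sub>a u)"

definition is_cone ::
  "('i, 'j) cat \<Rightarrow> ('o, 'm) cat \<Rightarrow> ('i \<Rightarrow> 'o) \<Rightarrow> ('j \<Rightarrow> 'm) \<Rightarrow> 'o \<Rightarrow> ('i \<Rightarrow> 'm) \<Rightarrow> bool" where
  "is_cone J C F\<^sub>o F\<^sub>a X \<xi> \<longleftrightarrow>
     X \<in> Obj C \<and>
     (\<forall>i\<in>Obj J. \<xi> i \<in> Hom C X (F\<^sub>o i)) \<and>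
     (\<forall>i j. \<forall>u\<in>Hom J i j. F\<^sub>a u \<cdot>\<^bsub>C\<^esub> \<xi> i = \<xi> j)"

definition is_limit ::
  "('i, 'j) cat \<Rightarrow> ('o, 'm) cat \<Rightarrow> ('i \<Rightarrow> 'o) \<Rightarrow> ('j \<Rightarrow> 'm) \<Rightarrow> 'o \<Rightarrow> ('i \<Rightarrow> 'm) \<Rightarrow> bool" where
  "is_limit J C F\<^sub>o F\<^sub>a L \<pi> \<longleftrightarrow>
     is_functor J C F\<^sub>o F\<^sub>a \<and> is_cone J C F\<^sub>o F\<^sub>a L \<pi> \<and>
     (\<forall>X \<xi>. is_cone J C F\<^sub>o F\<^sub>a X \<xi> \<longrightarrow>
        (\<exists>!h. h \<in> Hom C X L \<and> (\<forall>i\<in>Obj J. \<pi> i \<cdot>\<^bsub>C\<^esub> h = \<xi> i)))"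

text \<open>Every finite category is isomorphic to one whose objects and arrows are natural numbers,
  so it suffices to quantify over shapes of that type.\<close>

definition has_finite_limits :: "('o, 'm) cat \<Rightarrow> bool" where
  "has_finite_limits C \<longleftrightarrow>
     (\<forall>(J :: (nat, nat) cat) F\<^sub>o F\<^sub>a.
        finite (Obj J) \<and> finite (Arr J) \<and> is_functor J C F\<^sub>o F\<^sub>a \<longrightarrow>
        (\<exists>L \<pi>. is_limit J C F\<^sub>o F\<^sub>a L \<pi>))"

definition is_product ::
  "('o, 'm) cat \<Rightarrow> 'o \<Rightarrow> 'o \<Rightarrow> 'o \<Rightarrow> 'm \<Rightarrow> 'm \<Rightarrow> bool" where
  "is_product C A B P p q \<longleftrightarrow>
     P \<in> Obj C \<and> p \<in> Hom C P A \<and> q \<in> Hom C P B \<and>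
     (\<forall>X. \<forall>f\<in>Hom C X A. \<forall>g\<in>Hom C X B.
        \<exists>!h. h \<in> Hom C X P \<and> p \<cdot>\<^bsub>C\<^esub> h = f \<and> q \<cdot>\<^bsub>C\<^esub> h = g)"

definition is_pullback :: "('o, 'm) cat \<Rightarrow> 'm \<Rightarrow> 'm \<Rightarrow> 'm \<Rightarrow> 'm \<Rightarrow> bool" where
  "is_pullback C f g p q \<longleftrightarrow>
     f \<in> Arr C \<and> g \<in> Arr C \<and> Cod C f = Cod C g \<and>
     p \<in> Hom C (Dom C p) (Dom C f) \<and> q \<in> Hom C (Dom C p) (Dom C g) \<and>
     f \<cdot>\<^bsub>C\<^esub> p = g \<cdot>\<^bsub>C\<^esub> q \<and>
     (\<forall>X. \<forall>a\<in>Hom C X (Dom C f). \<forall>b\<in>Hom C X (Dom C g).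
        f \<cdot>\<^bsub>C\<^esub> a = g \<cdot>\<^bsub>C\<^esub> b \<longrightarrow>
        (\<exists>!h. h \<in> Hom C X (Dom C p) \<and> p \<cdot>\<^bsub>C\<^esub> h = a \<and> q \<cdot>\<^bsub>C\<^esub> h = b))"


section \<open>Subobjects\<close>

definition monic :: "('o, 'm) cat \<Rightarrow> 'm \<Rightarrow> bool" where
  "monic C m \<longleftrightarrow>
     m \<in> Arr C \<and>
     (\<forall>X. \<forall>f\<in>Hom C X (Dom C m). \<forall>g\<in>Hom C X (Dom C m).
        m \<cdot>\<^bsub>C\<^esub> f = m \<cdot>\<^bsub>C\<^esub> g \<longrightarrow> f = g)"

definition is_iso :: "('o, 'm) cat \<Rightarrow> 'm \<Rightarrow> bool" where
  "is_iso C f \<longleftrightarrow>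
     f \<in> Arr C \<and>
     (\<exists>g\<in>Hom C (Cod C f) (Dom C f).
        g \<cdot>\<^bsub>C\<^esub> f = Idn C (Dom C f) \<and> f \<cdot>\<^bsub>C\<^esub> g = Idn C (Cod C f))"

definition Monos :: "('o, 'm) cat \<Rightarrow> 'o \<Rightarrow> 'm set" where
  "Monos C A = {m. monic C m \<and> Cod C m = A}"

definition sub_class :: "('o, 'm) cat \<Rightarrow> 'm \<Rightarrow> 'm set" where
  "sub_class C m =
     {n \<in> Monos C (Cod C m). \<exists>k\<in>Hom C (Dom C n) (Dom C m). is_iso C k \<and> m \<cdot>\<^bsub>C\<^esub> k = n}"

definition Sub :: "('o, 'm) cat \<Rightarrow> 'o \<Rightarrow> 'm set gorder" where
  "Sub C A =
     \<lparr>carrier = sub_class C ` Monos C A, eq = (=),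
      le = (\<lambda>x y. \<exists>m\<in>x. \<exists>n\<in>y. \<exists>k\<in>Hom C (Dom C m) (Dom C n). n \<cdot>\<^bsub>C\<^esub> k = m)\<rparr>"

text \<open>The shape of the diagram formed by a family \<open>M\<close> of monomorphisms with common codomain:
  \<open>None\<close> indexes the codomain, \<open>Some m\<close> indexes the domain of \<open>m\<close>, and the only
  nonidentity arrows are the pairs \<open>(Some m, None)\<close>, to be sent to \<open>m\<close>.\<close>

definition wide_cospan :: "'m set \<Rightarrow> ('m option, 'm option \<times> 'm option) cat" where
  "wide_cospan M =
     \<lparr>Obj = insert None (Some ` M),
      Arr = {(i, j). i \<in> insert None (Some ` M) \<and> (j = i \<or> j = None)},
      Dom = fst, Cod = snd, Idn = (\<lambda>i. (i, i)), Cmp = (\<lambda>v u. (fst u, snd v))\<rparr>"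

definition wide_cospan_obj :: "('o, 'm) cat \<Rightarrow> 'o \<Rightarrow> 'm option \<Rightarrow> 'o" where
  "wide_cospan_obj C A i = (case i of None \<Rightarrow> A | Some m \<Rightarrow> Dom C m)"

definition wide_cospan_arr :: "('o, 'm) cat \<Rightarrow> 'o \<Rightarrow> 'm option \<times> 'm option \<Rightarrow> 'm" where
  "wide_cospan_arr C A u =
     (case u of
        (Some m, None) \<Rightarrow> m
      | (i, _) \<Rightarrow> Idn C (wide_cospan_obj C A i))"

text \<open>Meets in \<open>Sub C A\<close> are limits in \<open>C\<close>: the meet of a family of subobjects, presented by
  choosing one monomorphism from each, is represented by the leg at \<open>None\<close> of a limit
  of the diagram those monomorphisms form. The empty family gives \<open>A\<close> itself.\<close>

definition meets_are_limits :: "('o, 'm) cat \<Rightarrow> 'o \<Rightarrow> bool" where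
  "meets_are_limits C A \<longleftrightarrow>
     (\<forall>M. M \<subseteq> Monos C A \<and> inj_on (sub_class C) M \<longrightarrow>
        (\<exists>L \<pi>. is_limit (wide_cospan M) C (wide_cospan_obj C A) (wide_cospan_arr C A) L \<pi> \<and>
               \<pi> None \<in> \<Sqinter>\<^bsub>Sub C A\<^esub> (sub_class C ` M)))"

text \<open>The type \<open>'u\<close> plays the role of the universe of sets: by limitation of size, a collection
  is a set iff it is strictly smaller than that universe. No relation between \<open>'u\<close> and the
  types of objects and arrows is assumed.\<close>

definition well_powered :: "'u itself \<Rightarrow> ('o, 'm) cat \<Rightarrow> bool" where
  "well_powered U C \<longleftrightarrow> (\<forall>A\<in>Obj C. carrier (Sub C A) \<prec> (UNIV :: 'u set))"

definition well_powered_finitely_well_complete :: "'u itself \<Rightarrow> ('o, 'm) cat \<Rightarrow> bool" where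
  "well_powered_finitely_well_complete U C \<longleftrightarrow>
     category C \<and> has_finite_limits C \<and> well_powered U C \<and>
     (\<forall>A\<in>Obj C. complete_lattice (Sub C A) \<and> meets_are_limits C A)"


section \<open>Internal equivalence relations\<close>

text \<open>A chosen product \<open>A \<times> A\<close>; a different choice changes everything below only along the
  canonical isomorphism.\<close>

definition square :: "('o, 'm) cat \<Rightarrow> 'o \<Rightarrow> 'o \<times> 'm \<times> 'm" where
  "square C A = (SOME (P, p, q). is_product C A A P p q)"

definition sq :: "('o, 'm) cat \<Rightarrow> 'o \<Rightarrow> 'o" where
  "sq C A = fst (square C A)"

definition pr1 :: "('o, 'm) cat \<Rightarrow> 'o \<Rightarrow> 'm" where
  "pr1 C A = fst (snd (square C A))"

definition pr2 :: "('o, 'm) cat \<Rightarrow> 'o \<Rightarrow> 'm" where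
  "pr2 C A = snd (snd (square C A))"

definition sq_map :: "('o, 'm) cat \<Rightarrow> 'm \<Rightarrow> 'm" where
  "sq_map C \<alpha> =
     (THE h. h \<in> Hom C (sq C (Dom C \<alpha>)) (sq C (Cod C \<alpha>)) \<and>
        pr1 C (Cod C \<alpha>) \<cdot>\<^bsub>C\<^esub> h = \<alpha> \<cdot>\<^bsub>C\<^esub> pr1 C (Dom C \<alpha>) \<and>
        pr2 C (Cod C \<alpha>) \<cdot>\<^bsub>C\<^esub> h = \<alpha> \<cdot>\<^bsub>C\<^esub> pr2 C (Dom C \<alpha>))"

definition internal_equivalence :: "('o, 'm) cat \<Rightarrow> 'o \<Rightarrow> 'm \<Rightarrow> bool" where
  "internal_equivalence C A r \<longleftrightarrow>
     r \<in> Monos C (sq C A) \<and>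
     (let R = Dom C r; r1 = pr1 C A \<cdot>\<^bsub>C\<^esub> r; r2 = pr2 C A \<cdot>\<^bsub>C\<^esub> r in
        (\<exists>e\<in>Hom C A R. r1 \<cdot>\<^bsub>C\<^esub> e = Idn C A \<and> r2 \<cdot>\<^bsub>C\<^esub> e = Idn C A) \<and>
        (\<exists>s\<in>Hom C R R. r1 \<cdot>\<^bsub>C\<^esub> s = r2 \<and> r2 \<cdot>\<^bsub>C\<^esub> s = r1) \<and>
        (\<exists>p q. is_pullback C r2 r1 p q \<and>
           (\<exists>t\<in>Hom C (Dom C p) R. r1 \<cdot>\<^bsub>C\<^esub> t = r1 \<cdot>\<^bsub>C\<^esub> p \<and> r2 \<cdot>\<^bsub>C\<^esub> t = r2 \<cdot>\<^bsub>C\<^esub> q)))"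

definition ER :: "('o, 'm) cat \<Rightarrow> 'o \<Rightarrow> 'm set gorder" where
  "ER C A = Sub C (sq C A)
     \<lparr>carrier := {x \<in> carrier (Sub C (sq C A)). \<exists>r\<in>x. internal_equivalence C A r}\<rparr>"

text \<open>The monomorphisms that are pullbacks along \<open>\<alpha> \<times> \<alpha>\<close> of some representative of \<open>x\<close> are
  exactly the members of one isomorphism class, so no choice of pullback is needed.\<close>

definition ER_map :: "('o, 'm) cat \<Rightarrow> 'm \<Rightarrow> 'm set \<Rightarrow> 'm set" where
  "ER_map C \<alpha> x = {n. \<exists>m\<in>x. \<exists>k. is_pullback C (sq_map C \<alpha>) m n k}"

definition commutator :: "('o, 'm) cat \<Rightarrow> ('o \<Rightarrow> 'm set \<Rightarrow> 'm set \<Rightarrow> 'm set) \<Rightarrow> bool" where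
  "commutator C K \<longleftrightarrow>
     (\<forall>A\<in>Obj C. \<forall>x\<in>carrier (ER C A). \<forall>y\<in>carrier (ER C A).
        K A x y \<in> carrier (ER C A) \<and> K A x y \<sqsubseteq>\<^bsub>ER C A\<^esub> x \<sqinter>\<^bsub>ER C A\<^esub> y) \<and>
     (\<forall>A\<in>Obj C. \<forall>B\<in>Obj C. \<forall>\<alpha>\<in>Hom C A B. \<forall>x\<in>carrier (ER C B). \<forall>y\<in>carrier (ER C B).
        K A (ER_map C \<alpha> x) (ER_map C \<alpha> y) \<sqsubseteq>\<^bsub>ER C A\<^esub> ER_map C \<alpha> (K B x y))"


section \<open>Multiplicative lattices and their spectra\<close>

locale complete_multiplicative_lattice = complete_lattice L
  for L :: "('a, 'b) gorder_scheme" (structure) +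
  fixes mul :: "'a \<Rightarrow> 'a \<Rightarrow> 'a"
  assumes mul_closed: "x \<in> carrier L \<Longrightarrow> y \<in> carrier L \<Longrightarrow> mul x y \<in> carrier L"
    and mul_le_meet: "x \<in> carrier L \<Longrightarrow> y \<in> carrier L \<Longrightarrow> mul x y \<sqsubseteq> x \<sqinter> y"

definition primes :: "('a, 'b) gorder_scheme \<Rightarrow> ('a \<Rightarrow> 'a \<Rightarrow> 'a) \<Rightarrow> 'a set" where
  "primes L mul =
     {p \<in> carrier L. p \<noteq> \<top>\<^bsub>L\<^esub> \<and>
        (\<forall>x\<in>carrier L. \<forall>y\<in>carrier L.
           mul x y \<sqsubseteq>\<^bsub>L\<^esub> p \<longrightarrow> x \<sqsubseteq>\<^bsub>L\<^esub> p \<or> y \<sqsubseteq>\<^bsub>L\<^esub> p)}"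

definition zariski_closed ::
  "('a, 'b) gorder_scheme \<Rightarrow> ('a \<Rightarrow> 'a \<Rightarrow> 'a) \<Rightarrow> 'a \<Rightarrow> 'a set" where
  "zariski_closed L mul x = {p \<in> primes L mul. x \<sqsubseteq>\<^bsub>L\<^esub> p}"

definition Spec :: "('a, 'b) gorder_scheme \<Rightarrow> ('a \<Rightarrow> 'a \<Rightarrow> 'a) \<Rightarrow> 'a topology" where
  "Spec L mul =
     topology (\<lambda>U. \<exists>x\<in>carrier L. U = primes L mul - zariski_closed L mul x)"

definition irreducible_closedin :: "'a topology \<Rightarrow> 'a set \<Rightarrow> bool" where
  "irreducible_closedin X S \<longleftrightarrow>
     closedin X S \<and> S \<noteq> {} \<and>
     (\<forall>F G. closedin X F \<and> closedin X G \<and> S = F \<union> G \<longrightarrow> S = F \<or> S = G)"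

definition sober_space :: "'a topology \<Rightarrow> bool" where
  "sober_space X \<longleftrightarrow>
     t0_space X \<and>
     (\<forall>S. irreducible_closedin X S \<longrightarrow> (\<exists>p\<in>topspace X. S = X closure_of {p}))"

end

theory Submission
  imports Defs
begin

text \<open>Every mono \<open>r\<close> into \<open>A \<times> A\<close> induces, for each object \<open>X\<close>, a relation on the arrows \<open>X \<rightarrow> A\<close>, and
  \<open>r\<close> is an internal equivalence relation iff all these relations are equivalences. The limit of a
  wide cospan of monos induces the intersection of the relations induced by those monos, so \<open>ER(A)\<close>
  is closed under the meets of \<open>Sub(A \<times> A)\<close> and is therefore a complete lattice.

  Sobriety is a property of any complete lattice with \<open>xy \<le> x \<and> y\<close>: there \<open>V(xy) = V(x) \<union> V(y)\<close>,
  so the infimum of an irreducible closed set is prime and is its generic point.\<close>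

section \<open>Spectra of complete multiplicative lattices\<close>

context complete_multiplicative_lattice
begin

lemma mul_le_left: "x \<in> carrier L \<Longrightarrow> y \<in> carrier L \<Longrightarrow> mul x y \<sqsubseteq> x"
  and mul_le_right: "x \<in> carrier L \<Longrightarrow> y \<in> carrier L \<Longrightarrow> mul x y \<sqsubseteq> y"
  by (meson mul_closed mul_le_meet meet_left meet_right meet_closed le_trans)+

lemma primes_closed: "p \<in> primes L mul \<Longrightarrow> p \<in> carrier L"
  by (simp add: primes_def)

lemma zariski_closed_subset: "zariski_closed L mul x \<subseteq> primes L mul"
  by (auto simp: zariski_closed_def)

text \<open>One inclusion is primality of \<open>p\<close>; the other holds because a product lies
  below each of its factors. Finite unions of closed sets are thereby closed.\<close>

lemma zariski_closed_mul:
  assumes "x \<in> carrier L" "y \<in> carrier L"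
  shows "zariski_closed L mul (mul x y) = zariski_closed L mul x \<union> zariski_closed L mul y"
proof -
  have "mul x y \<sqsubseteq> p \<longleftrightarrow> x \<sqsubseteq> p \<or> y \<sqsubseteq> p" if p: "p \<in> primes L mul" for p
  proof
    show "mul x y \<sqsubseteq> p \<Longrightarrow> x \<sqsubseteq> p \<or> y \<sqsubseteq> p"
      using p assms by (simp add: primes_def)
    show "x \<sqsubseteq> p \<or> y \<sqsubseteq> p \<Longrightarrow> mul x y \<sqsubseteq> p"
      using le_trans[OF mul_le_left[OF assms] _ mul_closed[OF assms] assms(1) primes_closed[OF p]]
        le_trans[OF mul_le_right[OF assms] _ mul_closed[OF assms] assms(2) primes_closed[OF p]]
      by (elim disjE)
  qed
  then show ?thesis by (auto simp: zariski_closed_def)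
qed

text \<open>Lying above \<open>\<Squnion>X\<close> is the same as being an upper bound of
  \<open>X\<close>, so arbitrary intersections of closed sets are closed. Membership in
  \<open>primes\<close> is written separately so that empty \<open>X\<close> gives the whole
  spectrum.\<close>

lemma zariski_closed_sup:
  assumes "X \<subseteq> carrier L"
  shows "zariski_closed L mul (\<Squnion>X) = {p \<in> primes L mul. \<forall>x\<in>X. p \<in> zariski_closed L mul x}"
proof -
  have "\<Squnion>X \<sqsubseteq> p \<longleftrightarrow> (\<forall>x\<in>X. x \<sqsubseteq> p)" if "p \<in> carrier L" for p
    using assms that sup_upper[OF assms] sup_least[OF assms] sup_closed[OF assms] le_trans
    by (meson subsetD)
  then show ?thesis by (auto simp: zariski_closed_def primes_closed)
qed

text \<open>Primes are proper, and only \<open>\<top>\<close> lies above \<open>\<top>\<close>. The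
  complement of this empty set shows that the whole spectrum is open.\<close>

lemma zariski_closed_top: "zariski_closed L mul \<top> = {}"
proof -
  have "p = \<top>" if "p \<in> carrier L" "\<top> \<sqsubseteq> p" for p
    using that top_higher top_closed le_antisym by blast
  then show ?thesis
    by (auto simp: zariski_closed_def primes_def)
qed

section \<open>The Zariski topology\<close>

lemma istopology_zariski:
  "istopology (\<lambda>U. \<exists>x\<in>carrier L. U = primes L mul - zariski_closed L mul x)" (is "istopology ?open")
  unfolding istopology_def
proof (intro conjI allI impI)
  fix S T assume "?open S" "?open T"
  then obtain x y where "x \<in> carrier L" "S = primes L mul - zariski_closed L mul x"
    "y \<in> carrier L" "T = primes L mul - zariski_closed L mul y" by blast
  then show "?open (S \<inter> T)"
    by (intro bexI[of _ "mul x y"]) (auto simp: zariski_closed_mul mul_closed)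
next
  fix \<U> assume "\<forall>U\<in>\<U>. ?open U"
  \<comment> \<open>One element \<open>x U\<close> is chosen for each open set. The supremum of the
    choices cuts out the intersection of the complements; for empty \<open>\<U>\<close> it gives the
    empty open set.\<close>
  then obtain x where x: "\<And>U. U \<in> \<U> \<Longrightarrow> x U \<in> carrier L \<and> U = primes L mul - zariski_closed L mul (x U)"
    by metis
  then have sub: "x ` \<U> \<subseteq> carrier L" by auto
  have "\<Union>\<U> = (\<Union>U\<in>\<U>. primes L mul - zariski_closed L mul (x U))" using x by force
  also have "\<dots> = primes L mul - zariski_closed L mul (\<Squnion>(x ` \<U>))"
    unfolding zariski_closed_sup[OF sub] by auto
  finally show "?open (\<Union>\<U>)" using sup_closed[OF sub] by blast
qed

lemma openin_Spec:
  "openin (Spec L mul) U \<longleftrightarrow> (\<exists>x\<in>carrier L. U = primes L mul - zariski_closed L mul x)"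
  unfolding Spec_def by (simp add: topology_inverse'[OF istopology_zariski])

lemma topspace_Spec: "topspace (Spec L mul) = primes L mul"
proof -
  have "openin (Spec L mul) (primes L mul)"
    unfolding openin_Spec using zariski_closed_top top_closed by force
  then show ?thesis
    unfolding topspace_def openin_Spec by blast
qed

lemma closedin_Spec:
  "closedin (Spec L mul) S \<longleftrightarrow> (\<exists>x\<in>carrier L. S = zariski_closed L mul x)"
  unfolding closedin_def openin_Spec topspace_Spec
  using zariski_closed_subset by (metis double_diff subset_refl)

text \<open>The closed sets containing \<open>p\<close> are given by elements
  \<open>x \<sqsubseteq> p\<close>, and by transitivity each of them contains every prime above
  \<open>p\<close>.\<close>

lemma closure_of_singleton_Spec:
  assumes p: "p \<in> primes L mul"
  shows "Spec L mul closure_of {p} = zariski_closed L mul p"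
proof (rule closure_of_unique)
  show "{p} \<subseteq> zariski_closed L mul p"
    using p by (simp add: zariski_closed_def primes_closed)
  show "closedin (Spec L mul) (zariski_closed L mul p)"
    using p closedin_Spec primes_closed by blast
  fix T assume "{p} \<subseteq> T" "closedin (Spec L mul) T"
  then obtain x where "x \<in> carrier L" "T = zariski_closed L mul x" "x \<sqsubseteq> p"
    by (auto simp: closedin_Spec zariski_closed_def)
  then show "zariski_closed L mul p \<subseteq> T"
    using p by (auto simp: zariski_closed_def intro: le_trans primes_closed)
qed

section \<open>Separation and generic points\<close>

lemma t0_space_Spec: "t0_space (Spec L mul)"
  unfolding t0_space_def topspace_Spec
proof (intro ballI impI)
  fix p q assume pq: "p \<in> primes L mul" "q \<in> primes L mul" "p \<noteq> q"
  \<comment> \<open>By antisymmetry one of the two inequalities fails. If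
    \<open>p \<sqsubseteq> q\<close> fails, then \<open>p\<close> itself serves as \<open>x\<close>:
    the complement of its closed set contains \<open>q\<close> but not \<open>p\<close>.\<close>
  then have "\<not> p \<sqsubseteq> q \<or> \<not> q \<sqsubseteq> p"
    using le_antisym primes_closed by blast
  then have "\<exists>x\<in>carrier L. p \<in> primes L mul - zariski_closed L mul x \<longleftrightarrow>
      q \<notin> primes L mul - zariski_closed L mul x"
    unfolding zariski_closed_def using pq primes_closed le_refl
    by (metis (mono_tags, lifting) Diff_iff mem_Collect_eq)
  then show "\<exists>U. openin (Spec L mul) U \<and> (p \<notin> U \<longleftrightarrow> q \<in> U)"
    unfolding openin_Spec by blast
qed

text \<open>The element \<open>z\<close> defining \<open>S\<close> is a lower bound of
  \<open>S\<close>, hence below \<open>\<Sqinter>S\<close>, so both define the same closed set. If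
  \<open>mul x y \<sqsubseteq> \<Sqinter>S\<close>, then \<open>S\<close> is covered by the closed
  sets of \<open>x\<close> and \<open>y\<close>; irreducibility puts \<open>S\<close> inside one of
  them, which makes that factor a lower bound of \<open>S\<close>.\<close>

lemma inf_irreducible_prime:
  assumes irr: "irreducible_closedin (Spec L mul) S"
  shows "\<Sqinter>S \<in> primes L mul" and "S = zariski_closed L mul (\<Sqinter>S)"
proof -
  obtain z where z: "z \<in> carrier L" "S = zariski_closed L mul z"
    using irr by (auto simp: irreducible_closedin_def closedin_Spec)
  have Sp: "S \<subseteq> primes L mul" using z zariski_closed_subset by simp
  then have SL: "S \<subseteq> carrier L" using primes_closed by blast
  have sL: "\<Sqinter>S \<in> carrier L" by (rule inf_closed[OF SL])
  have low: "\<Sqinter>S \<sqsubseteq> p" if "p \<in> S" for p using that inf_lower SL by blast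
  have great: "x \<sqsubseteq> \<Sqinter>S" if "x \<in> carrier L" "S \<subseteq> zariski_closed L mul x" for x
    using that SL by (intro inf_greatest) (auto simp: zariski_closed_def)
  have "z \<sqsubseteq> \<Sqinter>S" using great z by blast
  then show eq: "S = zariski_closed L mul (\<Sqinter>S)"
    using low z Sp sL by (auto simp: zariski_closed_def intro: le_trans primes_closed)
  \<comment> \<open>Nonemptiness of \<open>S\<close> keeps the infimum proper, since no prime lies
    above \<open>\<top>\<close>.\<close>
  obtain p where p: "p \<in> S" using irr by (auto simp: irreducible_closedin_def)
  have "\<Sqinter>S \<noteq> \<top>" using eq p zariski_closed_top by auto
  moreover have "x \<sqsubseteq> \<Sqinter>S \<or> y \<sqsubseteq> \<Sqinter>S"
    if xy: "x \<in> carrier L" "y \<in> carrier L" "mul x y \<sqsubseteq> \<Sqinter>S" for x y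
  proof -
    let ?F = "S \<inter> zariski_closed L mul x" and ?G = "S \<inter> zariski_closed L mul y"
    have "S \<subseteq> zariski_closed L mul (mul x y)"
      using xy sL mul_closed low Sp SL by (auto simp: zariski_closed_def intro: le_trans)
    then have "S = ?F \<union> ?G"
      unfolding zariski_closed_mul[OF xy(1,2)] by blast
    moreover have "closedin (Spec L mul) (S \<inter> zariski_closed L mul w)" if "w \<in> carrier L" for w
      using that irr closedin_Spec by (intro closedin_Int) (auto simp: irreducible_closedin_def)
    then have "closedin (Spec L mul) ?F" "closedin (Spec L mul) ?G" using xy(1,2) by simp_all
    ultimately have "S = ?F \<or> S = ?G"
      using irr unfolding irreducible_closedin_def by meson
    then show ?thesis using great xy by blast
  qed
  ultimately show "\<Sqinter>S \<in> primes L mul" using sL by (simp add: primes_def)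
qed

theorem sober_space_Spec: "sober_space (Spec L mul)"
  unfolding sober_space_def topspace_Spec
proof (intro conjI allI impI t0_space_Spec)
  fix S assume "irreducible_closedin (Spec L mul) S"
  note generic = inf_irreducible_prime[OF this]
  show "\<exists>p\<in>primes L mul. S = Spec L mul closure_of {p}"
    by (rule bexI[OF _ generic(1)]) (simp only: closure_of_singleton_Spec[OF generic(1)] generic(2)[symmetric])
qed

end


section \<open>Binary products and pullbacks\<close>

context category
begin

lemma HomD: "f \<in> Hom C X Y \<Longrightarrow> f \<in> Arr C \<and> Dom C f = X \<and> Cod C f = Y \<and> X \<in> Obj C \<and> Y \<in> Obj C"
  using dom_in_Obj cod_in_Obj by (auto simp: Hom_def)

lemma binary_product_exists:
  assumes lim: "has_finite_limits C" and AB: "A \<in> Obj C" "B \<in> Obj C"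
  shows "\<exists>P p q. is_product C A B P p q"
proof -
  \<comment> \<open>The discrete shape with two objects: the numbers 0 and 1 serve both as objects
    and as their identities. A composable pair is one identity taken twice, so \<open>Cmp\<close>
    may return either argument. Cones are then just pairs of arrows.\<close>
  define J :: "(nat, nat) cat" where
    "J = \<lparr>Obj = {0, 1}, Arr = {0, 1}, Dom = id, Cod = id, Idn = id, Cmp = (\<lambda>v u. u)\<rparr>"
  define Fo where "Fo = (\<lambda>i::nat. if i = 0 then A else B)"
  have hom: "u \<in> Hom J i j \<longleftrightarrow> i = u \<and> j = u \<and> u \<in> {0, 1}" for u i j
    by (auto simp: J_def Hom_def)
  have J: "Obj J = {0, 1}" "Idn J i = i" "v \<cdot>\<^bsub>J\<^esub> u = u" "Dom J u = u" "Cod J u = u" for i u v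
    by (simp_all add: J_def)
  have "category J"
    by unfold_locales (simp_all add: hom J, simp_all add: J_def)
  moreover have Fo: "Fo i \<in> Obj C" for i using AB by (simp add: Fo_def)
  ultimately have "is_functor J C Fo (\<lambda>i. Idn C (Fo i))"
    using category_axioms Idn_in_Hom Cmp_Idn_left[OF Idn_in_Hom]
    by (auto simp: is_functor_def hom J)
  moreover have "finite (Obj J)" "finite (Arr J)" by (auto simp: J_def)
  ultimately obtain P \<pi> where P: "is_limit J C Fo (\<lambda>i. Idn C (Fo i)) P \<pi>"
    using lim unfolding has_finite_limits_def by blast
  have cone: "is_cone J C Fo (\<lambda>i. Idn C (Fo i)) X \<xi> \<longleftrightarrow> \<xi> 0 \<in> Hom C X A \<and> \<xi> 1 \<in> Hom C X B" for X \<xi>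
    using Cmp_Idn_left HomD unfolding is_cone_def
    by (auto simp: Fo_def hom J)
  have univ: "\<exists>!h. h \<in> Hom C X P \<and> \<pi> 0 \<cdot> h = f \<and> \<pi> 1 \<cdot> h = g"
    if "f \<in> Hom C X A" "g \<in> Hom C X B" for X f g
  proof -
    have "is_cone J C Fo (\<lambda>i. Idn C (Fo i)) X (\<lambda>i. if i = 0 then f else g)"
      using that by (simp add: cone)
    then have "\<exists>!h. h \<in> Hom C X P \<and> (\<forall>i\<in>Obj J. \<pi> i \<cdot> h = (if i = 0 then f else g))"
      using P unfolding is_limit_def by blast
    then show ?thesis by (simp add: J_def)
  qed
  have "\<pi> 0 \<in> Hom C P A" "\<pi> 1 \<in> Hom C P B" using P cone by (auto simp: is_limit_def)
  then have "is_product C A B P (\<pi> 0) (\<pi> 1)"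
    using univ HomD unfolding is_product_def by blast
  then show ?thesis by blast
qed

lemma pullback_exists:
  assumes lim: "has_finite_limits C" and f: "f \<in> Hom C A D" and g: "g \<in> Hom C B D"
  shows "\<exists>p q. is_pullback C f g p q"
proof -
  \<comment> \<open>The cospan shape: 0, 1, 2 are identities, 3 goes from 0 to 2 and 4 from 1 to 2.
    Only the identity 2 can follow 3 or 4, hence the composite is \<open>u\<close> in those cases
    and \<open>v\<close> when \<open>u\<close> is an identity.\<close>
  define J :: "(nat, nat) cat" where
    "J = \<lparr>Obj = {0, 1, 2}, Arr = {0, 1, 2, 3, 4},
          Dom = (\<lambda>u. if u = 3 then 0 else if u = 4 then 1 else u),
          Cod = (\<lambda>u. if u = 3 \<or> u = 4 then 2 else u),
          Idn = id, Cmp = (\<lambda>v u. if u \<le> 2 then v else u)\<rparr>"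
  define Fo where "Fo = (\<lambda>i::nat. if i = 0 then A else if i = 1 then B else D)"
  define Fa where "Fa = (\<lambda>u::nat. if u = 3 then f else if u = 4 then g else Idn C (Fo u))"
  have hom: "u \<in> Hom J i j \<longleftrightarrow>
      u = 0 \<and> i = 0 \<and> j = 0 \<or> u = 1 \<and> i = 1 \<and> j = 1 \<or> u = 2 \<and> i = 2 \<and> j = 2 \<or>
      u = 3 \<and> i = 0 \<and> j = 2 \<or> u = 4 \<and> i = 1 \<and> j = 2" for u i j
    by (auto simp: J_def Hom_def)
  have J: "Obj J = {0, 1, 2}" "Idn J i = i" "v \<cdot>\<^bsub>J\<^esub> u = (if u \<le> 2 then v else u)" for i u v
    by (simp_all add: J_def)
  have "category J"
  proof
    show "f \<in> Hom J X Y \<Longrightarrow> g \<in> Hom J Y Z \<Longrightarrow> g \<cdot>\<^bsub>J\<^esub> f \<in> Hom J X Z" for f g X Y Z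
      unfolding hom J by (elim disjE conjE; simp)
    show "f \<in> Hom J X Y \<Longrightarrow> f \<cdot>\<^bsub>J\<^esub> Idn J X = f" for f X Y
      unfolding hom J by (elim disjE conjE; simp)
    show "f \<in> Hom J X Y \<Longrightarrow> Idn J Y \<cdot>\<^bsub>J\<^esub> f = f" for f X Y
      unfolding hom J by (elim disjE conjE; simp)
    show "X \<in> Obj J \<Longrightarrow> Idn J X \<in> Hom J X X" for X
      unfolding hom J by auto
  qed (auto simp: J_def)
  moreover have Fo: "Fo i \<in> Obj C" for i using HomD[OF f] HomD[OF g] by (simp add: Fo_def)
  moreover have "Fa u \<in> Hom C (Fo i) (Fo j)" if "u \<in> Hom J i j" for u i j
    using that f g Idn_in_Hom[OF Fo[of u]] unfolding hom by (elim disjE conjE) (simp_all add: Fa_def Fo_def)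
  moreover have "Fa (v \<cdot>\<^bsub>J\<^esub> u) = Fa v \<cdot> Fa u" if "u \<in> Hom J i j" "v \<in> Hom J j k" for u v i j k
    using that Cmp_Idn_left[OF f] Cmp_Idn_right[OF f] Cmp_Idn_left[OF g] Cmp_Idn_right[OF g]
      Cmp_Idn_left[OF Idn_in_Hom[OF Fo[of u]]]
    unfolding hom J by (elim disjE conjE; simp add: Fa_def Fo_def)
  moreover have "Fa (Idn J i) = Idn C (Fo i)" if "i \<in> Obj J" for i
    using that unfolding J by (auto simp: Fa_def)
  ultimately have "is_functor J C Fo Fa"
    using category_axioms by (simp add: is_functor_def)
  moreover have "finite (Obj J)" "finite (Arr J)" by (auto simp: J_def)
  ultimately obtain P \<pi> where P: "is_limit J C Fo Fa P \<pi>"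
    using lim unfolding has_finite_limits_def by blast
  have cone: "is_cone J C Fo Fa X \<xi> \<longleftrightarrow>
      \<xi> 0 \<in> Hom C X A \<and> \<xi> 1 \<in> Hom C X B \<and> \<xi> 2 \<in> Hom C X D \<and> f \<cdot> \<xi> 0 = \<xi> 2 \<and> g \<cdot> \<xi> 1 = \<xi> 2"
    (is "_ \<longleftrightarrow> ?R") for X \<xi>
  proof
    assume c: "is_cone J C Fo Fa X \<xi>"
    have "3 \<in> Hom J 0 2" "4 \<in> Hom J 1 2" by (auto simp: hom)
    then have "Fa 3 \<cdot> \<xi> 0 = \<xi> 2" "Fa 4 \<cdot> \<xi> 1 = \<xi> 2" using c unfolding is_cone_def by blast+
    moreover have "\<xi> i \<in> Hom C X (Fo i)" if "i \<in> {0, 1, 2}" for i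
      using c that by (auto simp: is_cone_def J)
    from this[of 0] this[of 1] this[of 2]
    have "\<xi> 0 \<in> Hom C X A" "\<xi> 1 \<in> Hom C X B" "\<xi> 2 \<in> Hom C X D" by (auto simp: Fo_def)
    ultimately show ?R by (simp add: Fa_def)
  next
    assume R: ?R
    then have "Fa u \<cdot> \<xi> i = \<xi> j" if "u \<in> Hom J i j" for u i j
      using that Cmp_Idn_left unfolding hom by (elim disjE conjE) (auto simp: Fa_def Fo_def)
    then show "is_cone J C Fo Fa X \<xi>"
      using R HomD unfolding is_cone_def J by (auto simp: Fo_def)
  qed
  have univ: "\<exists>!h. h \<in> Hom C X P \<and> \<pi> 0 \<cdot> h = a \<and> \<pi> 1 \<cdot> h = b"
    if a: "a \<in> Hom C X A" and b: "b \<in> Hom C X B" and ab: "f \<cdot> a = g \<cdot> b" for X a b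
  proof -
    define \<xi> where "\<xi> = (\<lambda>i::nat. if i = 0 then a else if i = 1 then b else f \<cdot> a)"
    have "is_cone J C Fo Fa X \<xi>"
      using that Cmp_in_Hom[OF a f] by (simp add: cone \<xi>_def)
    then have u: "\<exists>!h. h \<in> Hom C X P \<and> (\<forall>i\<in>Obj J. \<pi> i \<cdot> h = \<xi> i)"
      using P unfolding is_limit_def by blast
    \<comment> \<open>The leg at 2 is determined by the leg at 0, so the equation at 2 follows from
      the one at 0, and unique existence for three equations becomes unique existence for
      two.\<close>
    have \<pi>: "\<pi> 0 \<in> Hom C P A" "\<pi> 2 = f \<cdot> \<pi> 0" using P cone by (auto simp: is_limit_def)
    have "(\<forall>i\<in>Obj J. \<pi> i \<cdot> h = \<xi> i) \<longleftrightarrow> \<pi> 0 \<cdot> h = a \<and> \<pi> 1 \<cdot> h = b" if "h \<in> Hom C X P" for h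
      using Cmp_assoc[OF that \<pi>(1) f] \<pi>(2) by (auto simp: J \<xi>_def)
    with u show ?thesis by (metis (no_types, lifting))
  qed
  have \<pi>: "\<pi> 0 \<in> Hom C P A" "\<pi> 1 \<in> Hom C P B" "f \<cdot> \<pi> 0 = g \<cdot> \<pi> 1"
    using P cone by (auto simp: is_limit_def)
  then have "is_pullback C f g (\<pi> 0) (\<pi> 1)"
    using univ f g HomD[OF \<pi>(1)] HomD[OF f] HomD[OF g] unfolding is_pullback_def by auto
  then show ?thesis by blast
qed

lemma square_is_product:
  assumes "has_finite_limits C" "A \<in> Obj C"
  shows "is_product C A A (sq C A) (pr1 C A) (pr2 C A)"
proof -
  have "\<exists>z. case z of (P, p, q) \<Rightarrow> is_product C A A P p q"
    using binary_product_exists[OF assms(1) assms(2,2)] by auto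
  then have "case square C A of (P, p, q) \<Rightarrow> is_product C A A P p q"
    unfolding square_def by (rule someI_ex)
  then show ?thesis by (simp add: sq_def pr1_def pr2_def split: prod.splits)
qed


section \<open>Subobjects and their intersections\<close>

text \<open>Cancelling the monos \<open>m\<close> and \<open>n\<close> shows that two mutual
  factorizations are inverse to each other. Subobjects can therefore be compared by factorization
  alone, without mentioning isomorphisms.\<close>

lemma sub_class_iff:
  assumes m: "m \<in> Monos C B"
  shows "n \<in> sub_class C m \<longleftrightarrow> n \<in> Monos C B \<and>
    (\<exists>k\<in>Hom C (Dom C n) (Dom C m). m \<cdot> k = n) \<and> (\<exists>l\<in>Hom C (Dom C m) (Dom C n). n \<cdot> l = m)"
    (is "_ \<longleftrightarrow> ?R")
proof
  have mH: "m \<in> Hom C (Dom C m) B" and mB: "Cod C m = B"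
    using m by (auto simp: Monos_def monic_def Hom_def)
  {
    assume "n \<in> sub_class C m"
    then obtain k where n: "n \<in> Monos C B" and k: "k \<in> Hom C (Dom C n) (Dom C m)" "is_iso C k" "m \<cdot> k = n"
      using mB by (auto simp: sub_class_def)
    obtain l where l: "l \<in> Hom C (Dom C m) (Dom C n)" "k \<cdot> l = Idn C (Dom C m)"
      using k by (auto simp: is_iso_def Hom_def)
    have "n \<cdot> l = m"
      using Cmp_assoc[OF l(1) k(1) mH] Cmp_Idn_right[OF mH] k(3) l(2) by simp
    then show ?R using n k l by blast
  next
    assume ?R
    then obtain k l where n: "n \<in> Monos C B"
      and k: "k \<in> Hom C (Dom C n) (Dom C m)" "m \<cdot> k = n"
      and l: "l \<in> Hom C (Dom C m) (Dom C n)" "n \<cdot> l = m" by blast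
    have nH: "n \<in> Hom C (Dom C n) B" using n by (auto simp: Monos_def monic_def Hom_def)
    have Obj: "Dom C m \<in> Obj C" "Dom C n \<in> Obj C" using HomD[OF k(1)] by auto
    have "m \<cdot> (k \<cdot> l) = m \<cdot> Idn C (Dom C m)"
      using Cmp_assoc[OF l(1) k(1) mH] k l Cmp_Idn_right[OF mH] by simp
    then have "k \<cdot> l = Idn C (Dom C m)"
      using m Cmp_in_Hom[OF l(1) k(1)] Idn_in_Hom[OF Obj(1)] unfolding Monos_def monic_def by blast
    moreover have "n \<cdot> (l \<cdot> k) = n \<cdot> Idn C (Dom C n)"
      using Cmp_assoc[OF k(1) l(1) nH] k l Cmp_Idn_right[OF nH] by simp
    then have "l \<cdot> k = Idn C (Dom C n)"
      using n Cmp_in_Hom[OF k(1) l(1)] Idn_in_Hom[OF Obj(2)] unfolding Monos_def monic_def by blast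
    ultimately have "is_iso C k" using k(1) l(1) by (auto simp: is_iso_def Hom_def)
    then show "n \<in> sub_class C m" using n k mB by (auto simp: sub_class_def)
  }
qed

lemma factors_trans:
  assumes "\<exists>k\<in>Hom C (Dom C m) (Dom C n). n \<cdot> k = m" and "\<exists>l\<in>Hom C (Dom C n) (Dom C p). p \<cdot> l = n"
    and p: "p \<in> Monos C B"
  shows "\<exists>k\<in>Hom C (Dom C m) (Dom C p). p \<cdot> k = m"
proof -
  obtain k l where k: "k \<in> Hom C (Dom C m) (Dom C n)" "n \<cdot> k = m"
    and l: "l \<in> Hom C (Dom C n) (Dom C p)" "p \<cdot> l = n" using assms by blast
  have "p \<in> Hom C (Dom C p) B" using p by (auto simp: Monos_def monic_def Hom_def)
  from Cmp_assoc[OF k(1) l(1) this] have "p \<cdot> (l \<cdot> k) = m" using k l by simp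
  then show ?thesis using Cmp_in_Hom[OF k(1) l(1)] by blast
qed

text \<open>Mutual factorization is an equivalence relation, so any member of a subobject may serve
  as its representative.\<close>

lemma sub_class_eq:
  assumes m: "m \<in> Monos C B" and n: "n \<in> sub_class C m"
  shows "sub_class C n = sub_class C m"
proof -
  have n': "n \<in> Monos C B" using n sub_class_iff[OF m] by blast
  note n_iff = n[unfolded sub_class_iff[OF m]]
  have "x \<in> sub_class C n \<longleftrightarrow> x \<in> sub_class C m" if x: "x \<in> Monos C B" for x
    unfolding sub_class_iff[OF m] sub_class_iff[OF n']
    using n_iff factors_trans[of x n m] factors_trans[of x m n]
      factors_trans[of m n x] factors_trans[of n m x] m n' x by blast
  then show ?thesis
    using sub_class_iff[OF m] sub_class_iff[OF n'] by blast
qed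

text \<open>A cone with vertex \<open>X\<close> is an arrow \<open>h\<close> into \<open>B\<close>
  together with a factorization of \<open>h\<close> through every \<open>m\<close>. The leg at
  \<open>None\<close> thus behaves as the intersection of the family; for empty \<open>M\<close>
  both sides hold.\<close>

lemma wide_cospan_factors:
  assumes M: "M \<subseteq> Monos C B"
    and lim: "is_limit (wide_cospan M) C (wide_cospan_obj C B) (wide_cospan_arr C B) L \<pi>"
    and h: "h \<in> Hom C X B"
  shows "(\<exists>k\<in>Hom C X L. \<pi> None \<cdot> k = h) \<longleftrightarrow> (\<forall>m\<in>M. \<exists>k\<in>Hom C X (Dom C m). m \<cdot> k = h)"
proof -
  let ?J = "wide_cospan M" and ?Fo = "wide_cospan_obj C B" and ?Fa = "wide_cospan_arr C B"
  have obj: "Obj ?J = insert None (Some ` M)" by (simp add: wide_cospan_def)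
  have hom: "u \<in> Hom ?J i j \<longleftrightarrow> u = (i, j) \<and> i \<in> insert None (Some ` M) \<and> (j = i \<or> j = None)" for u i j
    by (auto simp: wide_cospan_def Hom_def)
  have mH: "m \<in> Hom C (Dom C m) B" if "m \<in> M" for m
    using M that by (auto simp: Monos_def monic_def Hom_def)
  have cone: "is_cone ?J C ?Fo ?Fa Y \<xi> \<longleftrightarrow> \<xi> None \<in> Hom C Y B \<and>
      (\<forall>m\<in>M. \<xi> (Some m) \<in> Hom C Y (Dom C m) \<and> m \<cdot> \<xi> (Some m) = \<xi> None)" (is "_ \<longleftrightarrow> ?R") for Y \<xi>
  proof
    assume c: "is_cone ?J C ?Fo ?Fa Y \<xi>"
    have leg: "\<xi> i \<in> Hom C Y (?Fo i)" if "i \<in> insert None (Some ` M)" for i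
      using c that unfolding is_cone_def obj by blast
    have "m \<cdot> \<xi> (Some m) = \<xi> None" if "m \<in> M" for m
    proof -
      have "(Some m, None) \<in> Hom ?J (Some m) None" using that by (simp add: hom)
      then have "?Fa (Some m, None) \<cdot> \<xi> (Some m) = \<xi> None" using c unfolding is_cone_def by blast
      then show ?thesis by (simp add: wide_cospan_arr_def)
    qed
    moreover have "\<xi> (Some m) \<in> Hom C Y (Dom C m)" if "m \<in> M" for m
      using leg[of "Some m"] that by (simp add: wide_cospan_obj_def)
    moreover have "\<xi> None \<in> Hom C Y B"
      using leg[of None] by (simp add: wide_cospan_obj_def)
    ultimately show ?R by blast
  next
    assume R: ?R
    then have *: "\<xi> i \<in> Hom C Y (?Fo i)" if "i \<in> insert None (Some ` M)" for i
      using that by (auto simp: wide_cospan_obj_def)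
    have "?Fa (i, j) \<cdot> \<xi> i = \<xi> j" if "i \<in> insert None (Some ` M)" "j = i \<or> j = None" for i j
      using that R Cmp_Idn_left[OF *[OF that(1)]]
      by (auto simp: wide_cospan_arr_def split: option.splits)
    then show "is_cone ?J C ?Fo ?Fa Y \<xi>"
      using * R HomD unfolding is_cone_def obj by (auto simp: hom)
  qed
  have \<pi>: "\<pi> None \<in> Hom C L B" "\<And>m. m \<in> M \<Longrightarrow> \<pi> (Some m) \<in> Hom C L (Dom C m)"
    "\<And>m. m \<in> M \<Longrightarrow> m \<cdot> \<pi> (Some m) = \<pi> None"
    using lim by (auto simp: is_limit_def cone)
  show ?thesis
  proof
    assume "\<exists>k\<in>Hom C X L. \<pi> None \<cdot> k = h"
    then obtain k where k: "k \<in> Hom C X L" "\<pi> None \<cdot> k = h" by blast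
    then have "m \<cdot> (\<pi> (Some m) \<cdot> k) = h" if "m \<in> M" for m
      using \<pi>(3) Cmp_assoc[OF k(1) \<pi>(2) mH] that by simp
    then show "\<forall>m\<in>M. \<exists>k\<in>Hom C X (Dom C m). m \<cdot> k = h"
      using Cmp_in_Hom[OF k(1) \<pi>(2)] by blast
  next
    assume "\<forall>m\<in>M. \<exists>k\<in>Hom C X (Dom C m). m \<cdot> k = h"
    then obtain k where k: "\<And>m. m \<in> M \<Longrightarrow> k m \<in> Hom C X (Dom C m) \<and> m \<cdot> k m = h" by metis
    \<comment> \<open>The leg at \<open>None\<close> is \<open>h\<close>, and the leg at
      \<open>Some m\<close> is the chosen factorization \<open>k m\<close>.\<close>
    then have "is_cone ?J C ?Fo ?Fa X (case_option h k)"
      using h by (simp add: cone)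
    then have "\<exists>l\<in>Hom C X L. \<forall>i\<in>Obj ?J. \<pi> i \<cdot> l = case_option h k i"
      using lim unfolding is_limit_def by blast
    then show "\<exists>k\<in>Hom C X L. \<pi> None \<cdot> k = h"
      unfolding obj by force
  qed
qed

end


section \<open>Internal equivalence relations through generalized elements\<close>

text \<open>Arrows from \<open>X\<close> to \<open>A\<close> are generalized elements of
  \<open>A\<close>; \<open>f\<close> and \<open>g\<close> are related when their pairing factors
  through \<open>r\<close>. Using the composites of \<open>r\<close> with the projections avoids
  forming the pairing and matches the data in \<open>internal_equivalence\<close>.\<close>

definition points_related :: "('o, 'm) cat \<Rightarrow> 'o \<Rightarrow> 'm \<Rightarrow> 'o \<Rightarrow> 'm \<Rightarrow> 'm \<Rightarrow> bool" where
  "points_related C A r X f g \<longleftrightarrow>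
     (\<exists>k\<in>Hom C X (Dom C r). (pr1 C A \<cdot>\<^bsub>C\<^esub> r) \<cdot>\<^bsub>C\<^esub> k = f \<and> (pr2 C A \<cdot>\<^bsub>C\<^esub> r) \<cdot>\<^bsub>C\<^esub> k = g)"

context category
begin

text \<open>A Yoneda argument: composing with the structure maps gives the three properties at every
  \<open>X\<close>, and the properties at universal elements give the structure maps back.
  Reflexivity is relative to arrows into \<open>A\<close>, since only those can be related.\<close>

lemma internal_equivalence_iff_points:
  assumes lim: "has_finite_limits C" and A: "A \<in> Obj C" and r: "r \<in> Monos C (sq C A)"
  shows "internal_equivalence C A r \<longleftrightarrow>
    (\<forall>X. reflp_on (Hom C X A) (points_related C A r X) \<and>
         symp (points_related C A r X) \<and> transp (points_related C A r X))"
    (is "_ \<longleftrightarrow> ?R")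
proof -
  define R where "R = Dom C r"
  define r1 where "r1 = pr1 C A \<cdot> r"
  define r2 where "r2 = pr2 C A \<cdot> r"
  have rH: "r \<in> Hom C R (sq C A)"
    using r by (auto simp: R_def Monos_def monic_def Hom_def)
  have r1: "r1 \<in> Hom C R A" and r2: "r2 \<in> Hom C R A"
    using square_is_product[OF lim A] Cmp_in_Hom[OF rH] by (auto simp: r1_def r2_def is_product_def)
  have rel: "points_related C A r X f g \<longleftrightarrow> (\<exists>k\<in>Hom C X R. r1 \<cdot> k = f \<and> r2 \<cdot> k = g)" for X f g
    by (simp add: points_related_def R_def r1_def r2_def)
  note ie = internal_equivalence_def[of C A r, unfolded Let_def, folded R_def r1_def r2_def]
  have pb: "Dom C r1 = R" "Dom C r2 = R" using r1 r2 by (auto simp: Hom_def)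
  show ?thesis
  proof
    assume "internal_equivalence C A r"
    then obtain e s p q t where
      e: "e \<in> Hom C A R" "r1 \<cdot> e = Idn C A" "r2 \<cdot> e = Idn C A" and
      s: "s \<in> Hom C R R" "r1 \<cdot> s = r2" "r2 \<cdot> s = r1" and
      pq: "is_pullback C r2 r1 p q" and
      t: "t \<in> Hom C (Dom C p) R" "r1 \<cdot> t = r1 \<cdot> p" "r2 \<cdot> t = r2 \<cdot> q"
      unfolding ie by blast
    have p: "p \<in> Hom C (Dom C p) R" and q: "q \<in> Hom C (Dom C p) R"
      using pq pb by (auto simp: is_pullback_def)
    show ?R
    proof (intro allI conjI)
      fix X
      show "reflp_on (Hom C X A) (points_related C A r X)"
      proof (rule reflp_onI)
        fix f assume f: "f \<in> Hom C X A"
        then have "r1 \<cdot> (e \<cdot> f) = f" "r2 \<cdot> (e \<cdot> f) = f"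
          using e Cmp_assoc[OF f e(1) r1] Cmp_assoc[OF f e(1) r2] Cmp_Idn_left[OF f] by simp_all
        then show "points_related C A r X f f"
          unfolding rel using Cmp_in_Hom[OF f e(1)] by blast
      qed
      show "symp (points_related C A r X)"
      proof (rule sympI)
        fix f g assume "points_related C A r X f g"
        then obtain k where k: "k \<in> Hom C X R" "r1 \<cdot> k = f" "r2 \<cdot> k = g" unfolding rel by blast
        then have "r1 \<cdot> (s \<cdot> k) = g" "r2 \<cdot> (s \<cdot> k) = f"
          using s Cmp_assoc[OF k(1) s(1) r1] Cmp_assoc[OF k(1) s(1) r2] by simp_all
        then show "points_related C A r X g f"
          unfolding rel using Cmp_in_Hom[OF k(1) s(1)] by blast
      qed
      show "transp (points_related C A r X)"
      proof (rule transpI)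
        fix f g h assume "points_related C A r X f g" "points_related C A r X g h"
        then obtain k l where k: "k \<in> Hom C X R" "r1 \<cdot> k = f" "r2 \<cdot> k = g"
          and l: "l \<in> Hom C X R" "r1 \<cdot> l = g" "r2 \<cdot> l = h" unfolding rel by blast
        \<comment> \<open>The witnesses share the middle element,
          \<open>r2 \<cdot> k = g = r1 \<cdot> l\<close>, so they factor jointly through the
          pullback; \<open>t \<cdot> u\<close> then relates the outer elements.\<close>
        have "\<exists>!u. u \<in> Hom C X (Dom C p) \<and> p \<cdot> u = k \<and> q \<cdot> u = l"
          using pq k l unfolding is_pullback_def pb by simp
        then obtain u where u: "u \<in> Hom C X (Dom C p)" "p \<cdot> u = k" "q \<cdot> u = l" by blast
        have "r1 \<cdot> (t \<cdot> u) = f" "r2 \<cdot> (t \<cdot> u) = h"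
          using k l t u Cmp_assoc[OF u(1) t(1) r1] Cmp_assoc[OF u(1) t(1) r2]
            Cmp_assoc[OF u(1) p r1] Cmp_assoc[OF u(1) q r2] by simp_all
        then show "points_related C A r X f h"
          unfolding rel using Cmp_in_Hom[OF u(1) t(1)] by blast
      qed
    qed
  next
    assume R: ?R
    \<comment> \<open>The identity is the generic element of \<open>A\<close>; a witness of its
      reflexivity is the map \<open>e\<close>.\<close>
    have "points_related C A r A (Idn C A) (Idn C A)"
      using R Idn_in_Hom[OF A] by (blast dest: reflp_onD)
    then have "\<exists>e\<in>Hom C A R. r1 \<cdot> e = Idn C A \<and> r2 \<cdot> e = Idn C A" unfolding rel .
    moreover have "R \<in> Obj C" using HomD[OF r1] by simp
    \<comment> \<open>The generic related pair, witnessed by the identity of \<open>R\<close>;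
      reversing it produces \<open>s\<close>.\<close>
    then have "points_related C A r R r1 r2"
      unfolding rel using Idn_in_Hom Cmp_Idn_right[OF r1] Cmp_Idn_right[OF r2] by blast
    then have "points_related C A r R r2 r1" using R by (blast dest: sympD)
    then have "\<exists>s\<in>Hom C R R. r1 \<cdot> s = r2 \<and> r2 \<cdot> s = r1" unfolding rel .
    moreover obtain p q where pq: "is_pullback C r2 r1 p q"
      using pullback_exists[OF lim r2 r1] by blast
    then have p: "p \<in> Hom C (Dom C p) R" and q: "q \<in> Hom C (Dom C p) R" and eq: "r2 \<cdot> p = r1 \<cdot> q"
      using pb by (auto simp: is_pullback_def)
    \<comment> \<open>The generic chain of two related pairs lives on the vertex of the pullback,
      with witnesses \<open>p\<close> and \<open>q\<close>; transitivity produces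
      \<open>t\<close>.\<close>
    have "points_related C A r (Dom C p) (r1 \<cdot> p) (r2 \<cdot> p)"
      "points_related C A r (Dom C p) (r2 \<cdot> p) (r2 \<cdot> q)"
      unfolding rel using p q eq by auto
    then have "points_related C A r (Dom C p) (r1 \<cdot> p) (r2 \<cdot> q)" using R by (blast dest: transpD)
    then have "\<exists>t\<in>Hom C (Dom C p) R. r1 \<cdot> t = r1 \<cdot> p \<and> r2 \<cdot> t = r2 \<cdot> q" unfolding rel .
    ultimately show "internal_equivalence C A r"
      unfolding ie using r pq by blast
  qed
qed

text \<open>Arrows \<open>f\<close> and \<open>g\<close> into \<open>A\<close> have exactly one
  pairing \<open>h\<close>, so the factorizations through the various \<open>m\<close> all concern
  the same arrow and \<open>wide_cospan_factors\<close> applies to it. The typing of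
  \<open>f\<close> and \<open>g\<close> on the right carries the content when \<open>M\<close> is
  empty.\<close>

lemma points_related_wide_cospan:
  assumes lim: "has_finite_limits C" and A: "A \<in> Obj C"
    and M: "M \<subseteq> Monos C (sq C A)"
    and L: "is_limit (wide_cospan M) C (wide_cospan_obj C (sq C A)) (wide_cospan_arr C (sq C A)) L \<pi>"
  shows "points_related C A (\<pi> None) X f g \<longleftrightarrow>
    f \<in> Hom C X A \<and> g \<in> Hom C X A \<and> (\<forall>m\<in>M. points_related C A m X f g)"
proof -
  note prod = square_is_product[OF lim A, unfolded is_product_def]
  have pr: "pr1 C A \<in> Hom C (sq C A) A" "pr2 C A \<in> Hom C (sq C A) A" using prod by blast+
  have N: "\<pi> None \<in> Hom C L (sq C A)"
    using L by (auto simp: is_limit_def is_cone_def wide_cospan_def wide_cospan_obj_def)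
  \<comment> \<open>The pairing \<open>h\<close> is split off from its factorization through
    \<open>r\<close>, so that different monos can be compared on one \<open>h\<close>.\<close>
  have rel: "points_related C A r X f g \<longleftrightarrow>
      (\<exists>h\<in>Hom C X (sq C A). pr1 C A \<cdot> h = f \<and> pr2 C A \<cdot> h = g \<and> (\<exists>k\<in>Hom C X (Dom C r). r \<cdot> k = h))"
    if r: "r \<in> Hom C (Dom C r) (sq C A)" for r
    unfolding points_related_def
    using Cmp_assoc[OF _ r pr(1)] Cmp_assoc[OF _ r pr(2)] Cmp_in_Hom[OF _ r]
    by (auto 0 4)
  have relM: "points_related C A m X f g \<longleftrightarrow>
      (\<exists>h\<in>Hom C X (sq C A). pr1 C A \<cdot> h = f \<and> pr2 C A \<cdot> h = g \<and> (\<exists>k\<in>Hom C X (Dom C m). m \<cdot> k = h))"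
    if "m \<in> M" for m
    using that M by (intro rel) (auto simp: Monos_def monic_def Hom_def)
  have "Dom C (\<pi> None) = L" using N by (simp add: Hom_def)
  then have relN: "points_related C A (\<pi> None) X f g \<longleftrightarrow>
      (\<exists>h\<in>Hom C X (sq C A). pr1 C A \<cdot> h = f \<and> pr2 C A \<cdot> h = g \<and>
        (\<forall>m\<in>M. \<exists>k\<in>Hom C X (Dom C m). m \<cdot> k = h))"
    using rel[of "\<pi> None"] N wide_cospan_factors[OF M L] by auto
  show ?thesis
  proof
    assume "points_related C A (\<pi> None) X f g"
    then obtain h where h: "h \<in> Hom C X (sq C A)" "pr1 C A \<cdot> h = f" "pr2 C A \<cdot> h = g"
      and fac: "\<forall>m\<in>M. \<exists>k\<in>Hom C X (Dom C m). m \<cdot> k = h"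
      unfolding relN by (elim bexE conjE)
    have "points_related C A m X f g" if "m \<in> M" for m
      unfolding relM[OF that] using h bspec[OF fac that] by (intro bexI[of _ h]) simp_all
    then show "f \<in> Hom C X A \<and> g \<in> Hom C X A \<and> (\<forall>m\<in>M. points_related C A m X f g)"
      using h Cmp_in_Hom[OF h(1) pr(1)] Cmp_in_Hom[OF h(1) pr(2)] by simp
  next
    assume R: "f \<in> Hom C X A \<and> g \<in> Hom C X A \<and> (\<forall>m\<in>M. points_related C A m X f g)"
    then have ex1: "\<exists>!h. h \<in> Hom C X (sq C A) \<and> pr1 C A \<cdot> h = f \<and> pr2 C A \<cdot> h = g"
      using prod by blast
    then obtain h where h: "h \<in> Hom C X (sq C A)" "pr1 C A \<cdot> h = f" "pr2 C A \<cdot> h = g"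
      by (elim ex1E conjE)
    have "\<exists>k\<in>Hom C X (Dom C m). m \<cdot> k = h" if m: "m \<in> M" for m
    proof -
      have "points_related C A m X f g" using R m by simp
      then obtain h' where h': "h' \<in> Hom C X (sq C A)" "pr1 C A \<cdot> h' = f" "pr2 C A \<cdot> h' = g"
        and fac: "\<exists>k\<in>Hom C X (Dom C m). m \<cdot> k = h'"
        unfolding relM[OF m] by blast
      have "h' = h" using ex1 h h' by (elim ex1E) metis
      then show ?thesis using fac by simp
    qed
    then show "points_related C A (\<pi> None) X f g"
      unfolding relN using h by (intro bexI[of _ h]) simp_all
  qed
qed

text \<open>For each \<open>X\<close> the induced relation is an intersection of equivalences on the
  arrows from \<open>X\<close> to \<open>A\<close>; for empty \<open>M\<close> it is the total
  relation on them.\<close>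

lemma internal_equivalence_wide_cospan:
  assumes lim: "has_finite_limits C" and A: "A \<in> Obj C"
    and M: "\<And>m. m \<in> M \<Longrightarrow> internal_equivalence C A m"
    and L: "is_limit (wide_cospan M) C (wide_cospan_obj C (sq C A)) (wide_cospan_arr C (sq C A)) L \<pi>"
    and N: "\<pi> None \<in> Monos C (sq C A)"
  shows "internal_equivalence C A (\<pi> None)"
proof -
  have Mono: "M \<subseteq> Monos C (sq C A)" using M by (auto simp: internal_equivalence_def)
  note rel = points_related_wide_cospan[OF lim A Mono L]
  have "reflp_on (Hom C X A) (points_related C A m X) \<and>
      symp (points_related C A m X) \<and> transp (points_related C A m X)" if "m \<in> M" for m X
    using M[OF that] internal_equivalence_iff_points[OF lim A] Mono that by blast
  then show ?thesis
    unfolding internal_equivalence_iff_points[OF lim A N] reflp_on_def symp_def transp_def rel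
    by blast
qed

end


section \<open>The lattice of internal equivalence relations\<close>

text \<open>Infima computed in \<open>L\<close> remain greatest lower bounds inside
  \<open>S\<close>. Suprema in \<open>S\<close> arise as infima of upper bounds and may differ from
  those of \<open>L\<close>.\<close>

lemma (in complete_lattice) complete_lattice_restrict:
  assumes S: "S \<subseteq> carrier L" and inf: "\<And>X. X \<subseteq> S \<Longrightarrow> \<Sqinter>X \<in> S"
  shows "complete_lattice (L\<lparr>carrier := S\<rparr>)"
proof -
  interpret S: partial_order "L\<lparr>carrier := S\<rparr>"
    using S eq_is_equal by unfold_locales (auto intro: le_trans le_antisym)
  have *: "greatest (L\<lparr>carrier := S\<rparr>) (\<Sqinter>X) (Lower (L\<lparr>carrier := S\<rparr>) X)" if X: "X \<subseteq> S" for X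
    using X inf[OF X] S inf_lower[of X] inf_greatest[of X]
    unfolding greatest_def Lower_def by (auto simp: subset_iff)
  show ?thesis
    \<comment> \<open>The empty family supplies the greatest element, which the criterion asks for
      separately from infima of nonempty sets.\<close>
    by (rule S.complete_lattice_criterion1) (use *[of "{}"] * in auto)
qed

lemma complete_lattice_ER:
  assumes C: "well_powered_finitely_well_complete U C" and A: "A \<in> Obj C"
  shows "complete_lattice (ER C A)"
proof -
  interpret category C using C by (simp add: well_powered_finitely_well_complete_def)
  have lim: "has_finite_limits C" using C by (simp add: well_powered_finitely_well_complete_def)
  define B where "B = sq C A"
  have "B \<in> Obj C" using square_is_product[OF lim A] by (simp add: B_def is_product_def)
  then have "complete_lattice (Sub C B)" and meets: "meets_are_limits C B"
    using C by (auto simp: well_powered_finitely_well_complete_def)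
  then interpret Sub: complete_lattice "Sub C B" by simp
  have carrier: "carrier (Sub C B) = sub_class C ` Monos C B" by (simp add: Sub_def)
  have mem: "m \<in> Monos C B \<and> sub_class C m = x" if "x \<in> carrier (Sub C B)" "m \<in> x" for x m
    using that sub_class_eq sub_class_iff unfolding carrier by blast
  define S where "S = {x \<in> carrier (Sub C B). \<exists>r\<in>x. internal_equivalence C A r}"
  have "\<Sqinter>\<^bsub>Sub C B\<^esub> X \<in> S" if X: "X \<subseteq> S" for X
  proof -
    have "\<forall>x\<in>X. \<exists>r. r \<in> x \<and> internal_equivalence C A r"
      using X by (auto simp: S_def)
    \<comment> \<open>One equivalence relation is selected from each class. Each class is recovered
      from its representative, so \<open>sub_class\<close> is injective on the selection, as
      \<open>meets_are_limits\<close> requires.\<close>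
    from bchoice[OF this] obtain r where r: "\<forall>x\<in>X. r x \<in> x \<and> internal_equivalence C A (r x)" ..
    have XS: "X \<subseteq> carrier (Sub C B)" using X by (auto simp: S_def)
    have rX: "r x \<in> Monos C B" "sub_class C (r x) = x" if "x \<in> X" for x
      using mem r XS that by blast+
    have "r ` X \<subseteq> Monos C B" "inj_on (sub_class C) (r ` X)"
      using rX by (auto simp: inj_on_def)
    moreover have "sub_class C ` r ` X = X"
      using rX by force
    ultimately obtain L \<pi> where
      L: "is_limit (wide_cospan (r ` X)) C (wide_cospan_obj C B) (wide_cospan_arr C B) L \<pi>"
      and N: "\<pi> None \<in> \<Sqinter>\<^bsub>Sub C B\<^esub> X"
      using meets unfolding meets_are_limits_def by metis
    have inf: "\<Sqinter>\<^bsub>Sub C B\<^esub> X \<in> carrier (Sub C B)" by (rule Sub.inf_closed[OF XS])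
    \<comment> \<open>The leg is monic because it belongs to the subobject that is the meet.\<close>
    have "internal_equivalence C A (\<pi> None)"
      using internal_equivalence_wide_cospan[OF lim A _ L[unfolded B_def]] mem[OF inf N] r
      by (auto simp: B_def)
    then show ?thesis using inf N by (auto simp: S_def)
  qed
  then have "complete_lattice ((Sub C B)\<lparr>carrier := S\<rparr>)"
    by (intro Sub.complete_lattice_restrict) (auto simp: S_def)
  then show ?thesis by (simp add: ER_def S_def B_def)
qed

theorem theorem9p2:
  fixes C :: "('o, 'm) cat"
    and K :: "'o \<Rightarrow> 'm set \<Rightarrow> 'm set \<Rightarrow> 'm set"
    and A :: 'o
  assumes "well_powered_finitely_well_complete TYPE('u) C"
    and "commutator C K"
    and "A \<in> Obj C"
  shows "complete_multiplicative_lattice (ER C A) (K A) \<and> sober_space (Spec (ER C A) (K A))"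
proof -
  \<comment> \<open>The first commutator condition at \<open>A\<close> supplies closure and the
    bound by the meet.\<close>
  have "complete_multiplicative_lattice (ER C A) (K A)"
    using complete_lattice_ER[OF assms(1,3)] assms(2,3)
    by (simp add: complete_multiplicative_lattice_def complete_multiplicative_lattice_axioms_def
        commutator_def)
  then show ?thesis
    using complete_multiplicative_lattice.sober_space_Spec by blast
qed

end
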